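(* Let $r$ be a positive rational number such that $\alpha=\sqrt{r}$ is irrational. Then for every $\varepsilon>0$ there is a constant $C=C(\alpha,\varepsilon)>0$ such that $\delta_{\min}^{(\alpha)}(N)\le C\,N^{-1+\varepsilon}$ for all integers $N\ge 2$.
   Context: For irrational $\alpha>0$, the numbers $\alpha m^2+n^2$ with integers $m,n\ge 1$ (the Dirichlet eigenvalues of the Laplacian on a rectangle of width $\pi/\sqrt{\alpha}$ and height $\pi$) are pairwise distinct; list them in increasing order as $0<\lambda_1<\lambda_2<\cdots$. For $N\ge 2$ define the minimal gap $\delta_{\min}^{(\alpha)}(N)=\min\{\lambda_{i+1}-\lambda_i : 1\le i<N\}$. *)

theory Defs
  imports Complex_Main
begin

text \<open>The spectrum {alpha m^2 + n^2 : m, n >= 1} of the Dirichlet Laplacian on the rectangle.\<close>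
definition rect_spec :: "real \<Rightarrow> real set" where
  "rect_spec \<alpha> = {\<alpha> * real m ^ 2 + real n ^ 2 | m n :: nat. m \<ge> 1 \<and> n \<ge> 1}"

definition rect_eig :: "real \<Rightarrow> nat \<Rightarrow> real" where
  "rect_eig \<alpha> i = (THE x. x \<in> rect_spec \<alpha> \<and> card {y \<in> rect_spec \<alpha>. y < x} = i - 1)"

definition delta_min :: "real \<Rightarrow> nat \<Rightarrow> real" where
  "delta_min \<alpha> N = Min {rect_eig \<alpha> (i + 1) - rect_eig \<alpha> i | i. 1 \<le> i \<and> i < N}"

end

theory Submission
  imports Defs "HOL-Analysis.Kronecker_Approximation_Theorem"
begin

text \<open>
  Write \<open>\<alpha> = \<surd>D / q\<close>. A difference of two eigenvalues has the form
  \<open>\<alpha> (m\<^sup>2 - m'\<^sup>2) - (n\<^sup>2 - n'\<^sup>2)\<close>, so one looks for \<open>U\<close>, \<open>V\<close> with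
  \<open>\<bar>\<surd>D V - U\<bar>\<close> about \<open>1 / V\<close> such that both \<open>U\<close> and \<open>V\<close> split into two factors of
  nearly equal size. By Dirichlet's theorem there are \<open>x = u + v \<surd>D\<close> of bounded norm with
  \<open>x\<close> arbitrarily large; let \<open>y\<close> be its conjugate, \<open>X = x^k\<close>, \<open>Y = y^k\<close>. For \<open>L = 105^j\<close>
  take \<open>U = (X^L + Y^L) / 2\<close> and \<open>V = (X^L - Y^L) / (2 \<surd>D)\<close>. The splitting comes from
  \<open>X^105 - Y^105 = (X - Y) F G\<close>, where
  \<open>F = \<Phi>\<^sub>5 \<Phi>\<^sub>1\<^sub>0\<^sub>5\<close> and \<open>G = \<Phi>\<^sub>3 \<Phi>\<^sub>7 \<Phi>\<^sub>1\<^sub>5 \<Phi>\<^sub>2\<^sub>1 \<Phi>\<^sub>3\<^sub>5\<close> both have degree 52, and is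
  iterated \<open>j\<close> times; replacing \<open>Y\<close> by \<open>-Y\<close> treats \<open>U\<close>. The leftover factor
  \<open>X \<plusminus> Y\<close> has relative size \<open>1 / L\<close>, which costs only \<open>N^\<epsilon>\<close>.
\<close>

section \<open>Integrality and growth of symmetric binary forms\<close>

text \<open>X^2 and Y^2 are the roots of t^2 - (X^2 + Y^2) t + (X Y)^2, so their power sums obey a
  recurrence with integer coefficients.\<close>

lemma sum_even_powers_Ints:
  fixes X Y :: real
  assumes "X * Y \<in> \<int>" "X\<^sup>2 + Y\<^sup>2 \<in> \<int>"
  shows "(X ^ n)\<^sup>2 + (Y ^ n)\<^sup>2 \<in> \<int>"
proof (induction n rule: induct_nat_012)
  case (ge2 n)
  have "(X ^ Suc (Suc n))\<^sup>2 + (Y ^ Suc (Suc n))\<^sup>2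
      = (X\<^sup>2 + Y\<^sup>2) * ((X ^ Suc n)\<^sup>2 + (Y ^ Suc n)\<^sup>2) - (X * Y)\<^sup>2 * ((X ^ n)\<^sup>2 + (Y ^ n)\<^sup>2)"
    by (simp add: power2_eq_square algebra_simps)
  then show ?case
    using ge2 assms by (auto intro!: Ints_diff Ints_mult Ints_power)
qed (use assms in auto)

text \<open>
  Besides a bound of degree \<open>d\<close>, only integrality of \<open>X Y\<close> and \<open>X\<^sup>2 + Y\<^sup>2\<close> is used,
  since this hypothesis survives both \<open>Y \<mapsto> -Y\<close> and passing to powers.
\<close>
definition int_form :: "nat \<Rightarrow> (real \<Rightarrow> real \<Rightarrow> real) \<Rightarrow> bool" where
  "int_form d f \<longleftrightarrow>
     (\<forall>X Y. X * Y \<in> \<int> \<longrightarrow> X\<^sup>2 + Y\<^sup>2 \<in> \<int> \<longrightarrow> f X Y \<in> \<int>) \<and>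
     (\<exists>C\<ge>0. \<forall>X Y. \<bar>Y\<bar> \<le> X \<longrightarrow> \<bar>f X Y\<bar> \<le> C * X ^ d)"

lemma int_form_const_one: "int_form 0 (\<lambda>X Y. 1)"
  unfolding int_form_def by (auto intro!: exI[of _ 1])

lemma int_form_mult:
  assumes "int_form d f" "int_form e g"
  shows "int_form (d + e) (\<lambda>X Y. f X Y * g X Y)"
proof -
  obtain C E where C: "C \<ge> 0" "\<And>X Y. \<bar>Y\<bar> \<le> X \<Longrightarrow> \<bar>f X Y\<bar> \<le> C * X ^ d"
    and E: "E \<ge> 0" "\<And>X Y. \<bar>Y\<bar> \<le> X \<Longrightarrow> \<bar>g X Y\<bar> \<le> E * X ^ e"
    using assms unfolding int_form_def by metis
  have "\<bar>f X Y * g X Y\<bar> \<le> (C * E) * X ^ (d + e)" if "\<bar>Y\<bar> \<le> X" for X Y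
  proof -
    have "\<bar>f X Y\<bar> * \<bar>g X Y\<bar> \<le> (C * X ^ d) * (E * X ^ e)"
      using C E that by (intro mult_mono) auto
    then show ?thesis by (simp add: abs_mult power_add mult_ac)
  qed
  moreover have "C * E \<ge> 0" using C E by simp
  ultimately show ?thesis
    using assms unfolding int_form_def by (auto intro!: Ints_mult)
qed

lemma int_form_power_args:
  assumes "int_form d f"
  shows "int_form (n * d) (\<lambda>X Y. f (X ^ n) (Y ^ n))"
proof -
  obtain C where C: "C \<ge> 0" "\<And>X Y. \<bar>Y\<bar> \<le> X \<Longrightarrow> \<bar>f X Y\<bar> \<le> C * X ^ d"
    using assms unfolding int_form_def by metis
  have "\<bar>f (X ^ n) (Y ^ n)\<bar> \<le> C * X ^ (n * d)" if "\<bar>Y\<bar> \<le> X" for X Y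
    using C(2)[of "Y ^ n" "X ^ n"] that by (simp add: power_abs power_mono power_mult)
  moreover have "X ^ n * Y ^ n \<in> \<int>" if "X * Y \<in> \<int>" for X Y :: real
    using that by (metis Ints_power power_mult_distrib)
  ultimately show ?thesis
    using assms C(1) sum_even_powers_Ints unfolding int_form_def by blast
qed

text \<open>A homogeneous polynomial in s = X^2 + Y^2 and p = X Y, with \<open>cs\<close> ordered by
  ascending powers of s. Every palindromic integer form of even degree in X, Y can be written this
  way.\<close>

definition sym_form :: "int list \<Rightarrow> real \<Rightarrow> real \<Rightarrow> real" where
  "sym_form cs X Y =
     (\<Sum>i<length cs. of_int (cs ! i) * (X\<^sup>2 + Y\<^sup>2) ^ i * (X * Y) ^ (length cs - Suc i))"

text \<open>For |Y| \<le> X one has X^2 + Y^2 \<le> 2 X^2 and |X Y| \<le> X^2, so the i-th term adds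
  |c_i| 2^i to the constant.\<close>

lemma int_form_sym_form: "int_form (2 * (length cs - 1)) (sym_form cs)"
proof -
  define C :: real where "C = (\<Sum>i<length cs. \<bar>of_int (cs ! i)\<bar> * 2 ^ i)"
  have "\<bar>sym_form cs X Y\<bar> \<le> C * X ^ (2 * (length cs - 1))" if "\<bar>Y\<bar> \<le> X" for X Y
  proof -
    have X: "X \<ge> 0" using that by linarith
    have "\<bar>of_int (cs ! i) * (X\<^sup>2 + Y\<^sup>2) ^ i * (X * Y) ^ (length cs - Suc i)\<bar>
        \<le> (\<bar>of_int (cs ! i)\<bar> * 2 ^ i) * X ^ (2 * (length cs - 1))" if i: "i < length cs" for i
    proof -
      have "Y\<^sup>2 \<le> X\<^sup>2" using \<open>\<bar>Y\<bar> \<le> X\<close> by (metis X abs_le_square_iff abs_of_nonneg)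
      then have 1: "(X\<^sup>2 + Y\<^sup>2) ^ i \<le> (2 * X\<^sup>2) ^ i" by (intro power_mono) auto
      have 2: "\<bar>X * Y\<bar> ^ (length cs - Suc i) \<le> (X\<^sup>2) ^ (length cs - Suc i)"
        using X \<open>\<bar>Y\<bar> \<le> X\<close>
        by (intro power_mono) (auto simp: abs_mult power2_eq_square mult_left_mono)
      have "\<bar>of_int (cs ! i)\<bar> * (X\<^sup>2 + Y\<^sup>2) ^ i * \<bar>X * Y\<bar> ^ (length cs - Suc i)
          \<le> \<bar>of_int (cs ! i)\<bar> * (2 * X\<^sup>2) ^ i * (X\<^sup>2) ^ (length cs - Suc i)"
        by (intro mult_mono[OF mult_left_mono[OF 1] 2]) auto
      also have "\<dots> = (\<bar>of_int (cs ! i)\<bar> * 2 ^ i) * (X\<^sup>2) ^ (i + (length cs - Suc i))"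
        by (simp add: power_mult_distrib power_add mult_ac)
      also have "i + (length cs - Suc i) = length cs - 1" using i by simp
      finally show ?thesis
        by (simp add: abs_mult power_abs power_mult)
    qed
    then show ?thesis
      unfolding sym_form_def C_def sum_distrib_right
      by (intro order_trans[OF sum_abs] sum_mono) auto
  qed
  moreover have "C \<ge> 0" unfolding C_def by (intro sum_nonneg) auto
  moreover have "sym_form cs X Y \<in> \<int>" if "X * Y \<in> \<int>" "X\<^sup>2 + Y\<^sup>2 \<in> \<int>" for X Y
    unfolding sym_form_def
    by (intro Ints_sum Ints_mult[OF Ints_mult[OF Ints_of_int]] Ints_power that)
  ultimately show ?thesis unfolding int_form_def by blast
qed

section \<open>Balanced factorisation of X^105 - Y^105 and its iterates\<close>

text \<open>
  The homogenized cyclotomic polynomials, with coefficients in powers of \<open>s = X\<^sup>2 + Y\<^sup>2\<close> and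
  \<open>p = X Y\<close>; for example \<open>\<Phi>\<^sub>5 = s\<^sup>2 + s p - p\<^sup>2\<close>.
\<close>
definition cyclo_form_3 :: "real \<Rightarrow> real \<Rightarrow> real" where
  "cyclo_form_3 = sym_form [1, 1]"
definition cyclo_form_5 :: "real \<Rightarrow> real \<Rightarrow> real" where
  "cyclo_form_5 = sym_form [-1, 1, 1]"
definition cyclo_form_7 :: "real \<Rightarrow> real \<Rightarrow> real" where
  "cyclo_form_7 = sym_form [-1, -2, 1, 1]"
definition cyclo_form_21 :: "real \<Rightarrow> real \<Rightarrow> real" where
  "cyclo_form_21 = sym_form [1, -8, 8, 6, -6, -1, 1]"
definition cyclo_form_105 :: "real \<Rightarrow> real \<Rightarrow> real" where
  "cyclo_form_105 = sym_form
     [1, -32, -64, 528, 784, -3142, -4088, 9189, 11034, -15333, -17391, 15810, 17187,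
      -10506, -11067, 4573, 4709, -1294, -1312, 229, 230, -23, -23, 1, 1]"

lemmas cyclo_form_defs =
  cyclo_form_3_def cyclo_form_5_def cyclo_form_7_def cyclo_form_21_def cyclo_form_105_def

lemma int_form_cyclo_form:
  "int_form 2 cyclo_form_3" "int_form 4 cyclo_form_5" "int_form 6 cyclo_form_7"
  "int_form 12 cyclo_form_21" "int_form 48 cyclo_form_105"
  unfolding cyclo_form_defs
  using int_form_sym_form[of "[1, 1]"] int_form_sym_form[of "[-1, 1, 1]"]
    int_form_sym_form[of "[-1, -2, 1, 1]"] int_form_sym_form[of "[1, -8, 8, 6, -6, -1, 1]"]
    int_form_sym_form[of "[1, -32, -64, 528, 784, -3142, -4088, 9189, 11034, -15333, -17391,
      15810, 17187, -10506, -11067, 4573, 4709, -1294, -1312, 229, 230, -23, -23, 1, 1]"]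
  by simp_all

lemma power_5_diff_factor: "X ^ 5 - Y ^ 5 = (X - Y) * cyclo_form_5 X Y"
  unfolding cyclo_form_defs sym_form_def by (simp add: lessThan_Suc) algebra

lemma power_21_diff_factor:
  "X ^ 21 - Y ^ 21 = (X - Y) * cyclo_form_3 X Y * cyclo_form_7 X Y * cyclo_form_21 X Y"
  unfolding cyclo_form_defs sym_form_def by (simp add: lessThan_Suc) algebra

text \<open>5 is a prime not dividing 21, so \<Phi>_21(t^5) = \<Phi>_21(t) \<Phi>_105(t).\<close>

lemma cyclo_form_21_power_5:
  "cyclo_form_21 (X ^ 5) (Y ^ 5) = cyclo_form_21 X Y * cyclo_form_105 X Y"
proof -
  \<comment> \<open>Working in \<open>s\<close> and \<open>q\<close> halves the degree of the
    identity; the first formula below is a^5 + b^5 in terms of a + b = s and a b = q^2.\<close>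
  define s q where "s = X\<^sup>2 + Y\<^sup>2" and "q = X * Y"
  have s: "(X ^ 5)\<^sup>2 + (Y ^ 5)\<^sup>2 = s ^ 5 - 5 * s ^ 3 * q\<^sup>2 + 5 * s * q ^ 4"
    and q: "X ^ 5 * Y ^ 5 = q ^ 5"
    unfolding s_def q_def by algebra+
  show ?thesis
    unfolding cyclo_form_defs sym_form_def s q s_def[symmetric] q_def[symmetric]
    by (simp add: lessThan_Suc) algebra
qed

text \<open>In the factorisation for 21 at X^5, Y^5 only X^5 - Y^5 and \<Phi>_21 are split further.
  The two bracketed products have degrees 4 + 48 and 10 + 30 + 12, both 52.\<close>

lemma power_105_diff_factor:
  "X ^ 105 - Y ^ 105 = (X - Y) * (cyclo_form_5 X Y * cyclo_form_105 X Y) *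
     (cyclo_form_3 (X ^ 5) (Y ^ 5) * cyclo_form_7 (X ^ 5) (Y ^ 5) * cyclo_form_21 X Y)"
  using power_21_diff_factor[of "X ^ 5" "Y ^ 5"]
  by (simp add: power_5_diff_factor cyclo_form_21_power_5 mult_ac flip: power_mult)

text \<open>Induction: the factors for 105^j are evaluated at X^105, Y^105, and the remaining X^105
  - Y^105 is split by \<open>F\<close> and \<open>G\<close>. Both cofactors keep the same degree,
  half of 105^j - 1.\<close>

lemma power_105_power_diff_factor:
  obtains e a b where "2 * e + 1 = 105 ^ j" "int_form e a" "int_form e b"
    "\<And>X Y. X ^ (105 ^ j) - Y ^ (105 ^ j) = (X - Y) * a X Y * b X Y"
proof (induction j arbitrary: thesis)
  case 0
  then show ?case using int_form_const_one by force
next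
  case (Suc j)
  obtain e a b where e: "2 * e + 1 = (105::nat) ^ j" and ab: "int_form e a" "int_form e b"
    and eq: "\<And>X Y. X ^ (105 ^ j) - Y ^ (105 ^ j) = (X - Y) * a X Y * b X Y"
    using Suc.IH by blast
  define F where "F X Y = cyclo_form_5 X Y * cyclo_form_105 X Y" for X Y
  define G where "G X Y = cyclo_form_3 (X ^ 5) (Y ^ 5) * cyclo_form_7 (X ^ 5) (Y ^ 5) *
    cyclo_form_21 X Y" for X Y
  have F: "int_form 52 F" and G: "int_form 52 G"
    unfolding F_def G_def
    using int_form_mult[OF int_form_cyclo_form(2,5)]
      int_form_mult[OF int_form_mult[OF int_form_power_args[OF int_form_cyclo_form(1), of 5]
        int_form_power_args[OF int_form_cyclo_form(3), of 5]] int_form_cyclo_form(4)]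
    by simp_all
  show ?case
  proof (rule Suc.prems)
    show "2 * (105 * e + 52) + 1 = (105::nat) ^ Suc j" using e by simp
    show "int_form (105 * e + 52) (\<lambda>X Y. a (X ^ 105) (Y ^ 105) * F X Y)"
      "int_form (105 * e + 52) (\<lambda>X Y. b (X ^ 105) (Y ^ 105) * G X Y)"
      by (intro int_form_mult int_form_power_args ab F G)+
    show "X ^ (105 ^ Suc j) - Y ^ (105 ^ Suc j) = (X - Y) * (a (X ^ 105) (Y ^ 105) * F X Y) *
        (b (X ^ 105) (Y ^ 105) * G X Y)" for X Y
      using eq[of "X ^ 105" "Y ^ 105"] power_105_diff_factor[of X Y]
      unfolding F_def G_def by (simp add: power_mult mult_ac)
  qed
qed

section \<open>Counting the spectrum and bounding the minimal gap\<close>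

text \<open>The lattice points in the quarter ellipse are counted by its bounding box with sides
  sqrt (T / \<alpha>) and sqrt T.\<close>

lemma rect_spec_atMost:
  assumes "\<alpha> > 0"
  shows finite_rect_spec_atMost: "finite {y \<in> rect_spec \<alpha>. y \<le> T}"
    and card_rect_spec_atMost: "T \<ge> 0 \<Longrightarrow> real (card {y \<in> rect_spec \<alpha>. y \<le> T}) \<le> T / sqrt \<alpha>"
proof -
  define M N where "M = nat \<lfloor>sqrt (T / \<alpha>)\<rfloor>" and "N = nat \<lfloor>sqrt T\<rfloor>"
  let ?f = "\<lambda>(m, n). \<alpha> * real m ^ 2 + real n ^ 2"
  have sub: "{y \<in> rect_spec \<alpha>. y \<le> T} \<subseteq> ?f ` ({1..M} \<times> {1..N})"
  proof
    fix y assume "y \<in> {y \<in> rect_spec \<alpha>. y \<le> T}"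
    then obtain m n where y: "y = ?f (m, n)" "y \<le> T" "m \<ge> 1" "n \<ge> 1"
      unfolding rect_spec_def by auto
    have nn: "\<alpha> * real m ^ 2 \<ge> 0" using assms by simp
    have "real n ^ 2 \<le> T" "\<alpha> * real m ^ 2 \<le> T" using y nn by (auto intro: order_trans[rotated])
    then have "real n \<le> sqrt T" "real m \<le> sqrt (T / \<alpha>)"
      using assms by (auto intro!: real_le_rsqrt simp: field_simps)
    then have "m \<le> M" "n \<le> N" unfolding M_def N_def by (auto simp: le_nat_floor)
    then show "y \<in> ?f ` ({1..M} \<times> {1..N})" using y by auto
  qed
  show "finite {y \<in> rect_spec \<alpha>. y \<le> T}" by (rule finite_subset[OF sub]) auto
  assume T: "T \<ge> 0"
  have "card {y \<in> rect_spec \<alpha>. y \<le> T} \<le> card (?f ` ({1..M} \<times> {1..N}))"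
    by (intro card_mono sub) auto
  also have "\<dots> \<le> card ({1..M} \<times> {1..N})" by (intro card_image_le) auto
  also have "\<dots> = M * N" by simp
  finally have "real (card {y \<in> rect_spec \<alpha>. y \<le> T}) \<le> real M * real N"
    by (metis of_nat_le_iff of_nat_mult)
  also have "\<dots> \<le> sqrt (T / \<alpha>) * sqrt T"
    unfolding M_def N_def using T assms by (intro mult_mono of_nat_floor) auto
  also have "\<dots> = T / sqrt \<alpha>" using T by (simp add: real_sqrt_divide)
  finally show "real (card {y \<in> rect_spec \<alpha>. y \<le> T}) \<le> T / sqrt \<alpha>" .
qed

text \<open>The number of smaller eigenvalues is strictly increasing along the spectrum, so the
  definite description is unique.\<close>

lemma rect_eig_eqI:
  assumes "\<alpha> > 0" "x \<in> rect_spec \<alpha>" "card {y \<in> rect_spec \<alpha>. y < x} = i - 1"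
  shows "rect_eig \<alpha> i = x"
proof -
  have less: "card {y \<in> rect_spec \<alpha>. y < u} < card {y \<in> rect_spec \<alpha>. y < v}"
    if "u < v" "u \<in> rect_spec \<alpha>" for u v
  proof (rule psubset_card_mono)
    show "finite {y \<in> rect_spec \<alpha>. y < v}"
      by (rule finite_subset[OF _ finite_rect_spec_atMost[OF assms(1), of v]]) auto
  qed (use that in auto)
  show ?thesis
    unfolding rect_eig_def
  proof (rule the_equality)
    fix z assume "z \<in> rect_spec \<alpha> \<and> card {y \<in> rect_spec \<alpha>. y < z} = i - 1"
    then show "z = x" using less[of z x] less[of x z] assms by (metis less_irrefl linorder_neqE)
  qed (use assms in auto)
qed

lemma delta_min_le_rect_eig_diff:
  assumes "1 \<le> i" "i < N"
  shows "delta_min \<alpha> N \<le> rect_eig \<alpha> (i + 1) - rect_eig \<alpha> i"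
  unfolding delta_min_def using assms by (intro Min_le) auto

text \<open>The successor \<open>z\<close> of \<open>x\<close> in the spectrum is at most
  \<open>x'\<close>, so the consecutive gap z - x is no larger than x' - x.\<close>

lemma delta_min_le_diff:
  assumes "\<alpha> > 0" and x: "x \<in> rect_spec \<alpha>" "x' \<in> rect_spec \<alpha>" "x < x'"
    and N: "card {y \<in> rect_spec \<alpha>. y \<le> x'} \<le> N"
  shows "delta_min \<alpha> N \<le> x' - x"
proof -
  note fin = finite_rect_spec_atMost[OF assms(1)]
  define A where "A = {y \<in> rect_spec \<alpha>. x < y \<and> y \<le> x'}"
  define z where "z = Min A"
  have A: "finite A" "x' \<in> A"
    unfolding A_def using x by (auto intro: finite_subset[OF _ fin[of x']])
  then have zA: "z \<in> A" and zx': "z \<le> x'" unfolding z_def by (auto intro: Min_in)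
  have zmin: "z \<le> y" if "y \<in> rect_spec \<alpha>" "x < y" for y
  proof (cases "y \<le> x'")
    case True
    then show ?thesis using that A unfolding z_def A_def by auto
  qed (use zx' in linarith)
  define i where "i = Suc (card {y \<in> rect_spec \<alpha>. y < x})"
  have "{y \<in> rect_spec \<alpha>. y < z} = insert x {y \<in> rect_spec \<alpha>. y < x}"
    using zA zmin x unfolding A_def by force
  moreover have "finite {y \<in> rect_spec \<alpha>. y < x}" by (rule finite_subset[OF _ fin[of x]]) auto
  ultimately have card_z: "card {y \<in> rect_spec \<alpha>. y < z} = i" unfolding i_def by simp
  \<comment> \<open>\<open>z\<close> is counted on the right but not on the left, which gives the
    strict \<open>i < N\<close> that \<open>delta_min\<close> requires.\<close>
  have "card {y \<in> rect_spec \<alpha>. y < z} < card {y \<in> rect_spec \<alpha>. y \<le> x'}"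
  proof (rule psubset_card_mono)
    show "{y \<in> rect_spec \<alpha>. y < z} \<subset> {y \<in> rect_spec \<alpha>. y \<le> x'}"
      using zx' zA by (auto simp: A_def)
  qed (rule fin)
  then have "i < N" using card_z N by simp
  moreover have "rect_eig \<alpha> i = x" using assms by (intro rect_eig_eqI) (auto simp: i_def)
  moreover have "rect_eig \<alpha> (i + 1) = z"
    using assms zA card_z unfolding A_def by (intro rect_eig_eqI) auto
  ultimately show ?thesis
    using delta_min_le_rect_eig_diff[of i N \<alpha>] zx' by (simp add: i_def)
qed

section \<open>Small conjugates in Z[sqrt D]; products as differences of squares\<close>

text \<open>Dirichlet approximations u / v of \<theta> give y = u - v \<theta> with |y| < 1 / v and
  x = u + v \<theta> comparable to v, so |x y| stays below a fixed \<open>K\<close>. For v large,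
  \<open>K\<close> is at most x^\<eta>.\<close>

lemma irrational_sqrt_small_norm:
  fixes D :: nat
  defines "\<theta> \<equiv> sqrt (real D)"
  assumes "\<theta> \<notin> \<rat>" "0 < \<eta>"
  obtains u v :: int where "of_int u + of_int v * \<theta> > 1" "of_int u - of_int v * \<theta> \<noteq> 0"
    "\<bar>of_int u - of_int v * \<theta>\<bar> \<le> 1"
    "\<bar>of_int u - of_int v * \<theta>\<bar> \<le> (of_int u + of_int v * \<theta>) powr (\<eta> - 1)"
proof -
  have "D \<noteq> 0" using assms(2) unfolding \<theta>_def by (metis Rats_0 of_nat_0 real_sqrt_zero)
  then have \<theta>1: "\<theta> \<ge> 1" unfolding \<theta>_def by simp
  define K where "K = 2 * \<theta> + 1"
  have K: "K > 0" using \<theta>1 unfolding K_def by simp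
  have "infinite (approx_set \<theta>)" using assms(2) rational_iff_finite_approx_set by blast
  then obtain u v where uv: "(u, v) \<in> approx_set \<theta>" and vbig: "v > max 2 \<lceil>K powr (1 / \<eta>)\<rceil>"
    using infinite_approx_set by blast
  define x y where "x = of_int u + of_int v * \<theta>" and "y = of_int u - of_int v * \<theta>"
  have v: "v > 2" "of_int v \<ge> K powr (1 / \<eta>)" using vbig by (simp, linarith)
  have "\<bar>\<theta> - of_int u / of_int v\<bar> < 1 / (of_int v)\<^sup>2"
    using uv by (auto simp: approx_set_def)
  then have "\<bar>\<theta> - of_int u / of_int v\<bar> * of_int v < 1 / (of_int v)\<^sup>2 * of_int v"
    using v by (intro mult_strict_right_mono) auto
  moreover have "\<bar>\<theta> - of_int u / of_int v\<bar> * of_int v = \<bar>y\<bar>"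
    using v unfolding y_def by (simp add: abs_mult_pos field_simps abs_minus_commute)
  ultimately have y: "\<bar>y\<bar> < 1 / of_int v"
    using v by (simp add: power2_eq_square)
  have v1: "1 / real_of_int v \<le> 1" using v by simp
  have vt: "of_int v \<le> of_int v * \<theta>" using \<theta>1 v by simp
  have "real_of_int v > 2" using v by linarith
  then have xv: "x \<ge> of_int v" using y v1 vt unfolding x_def y_def by linarith
  have x1: "x > 1" using xv v by linarith
  have "\<bar>y\<bar> * x \<le> 1 / of_int v * x" using y x1 by (intro mult_right_mono) auto
  also have "\<dots> \<le> 1 / of_int v * (2 * (of_int v * \<theta>) + of_int v)"
  proof (rule mult_left_mono)
    show "x \<le> 2 * (of_int v * \<theta>) + of_int v"
      using \<open>real_of_int v > 2\<close> y v1 unfolding x_def y_def by linarith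
  qed (use v in auto)
  also have "\<dots> = K" using v unfolding K_def by (simp add: field_simps)
  finally have "\<bar>y\<bar> * x \<le> K" .
  also have "K = (K powr (1 / \<eta>)) powr \<eta>" using K assms(3) by (simp add: powr_powr)
  also have "\<dots> \<le> x powr \<eta>" using xv v assms(3) by (intro powr_mono2) auto
  finally have "\<bar>y\<bar> \<le> x powr (\<eta> - 1)"
    using x1 by (simp add: powr_diff field_simps)
  moreover have "y \<noteq> 0"
  proof
    assume "y = 0"
    then have "\<theta> = of_int u / of_int v" using v unfolding y_def by (simp add: field_simps)
    then show False using assms(2) by simp
  qed
  ultimately show thesis using that x1 y v1 unfolding x_def y_def by fastforce
qed

lemma quadratic_power_conjugates:
  fixes \<theta> :: real and D u v :: int
  assumes "\<theta>\<^sup>2 = of_int D"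
  obtains U V :: int where "(of_int u + of_int v * \<theta>) ^ k = of_int U + of_int V * \<theta>"
    "(of_int u - of_int v * \<theta>) ^ k = of_int U - of_int V * \<theta>"
proof (induction k arbitrary: thesis)
  case 0
  then show ?case by (metis add_0_right diff_0_right mult_zero_left of_int_0 of_int_1 power_0)
next
  case (Suc k)
  obtain U V :: int where UV: "(of_int u + of_int v * \<theta>) ^ k = of_int U + of_int V * \<theta>"
    "(of_int u - of_int v * \<theta>) ^ k = of_int U - of_int V * \<theta>"
    using Suc.IH by blast
  show ?case
    by (rule Suc.prems[of "u * U + D * v * V" "u * V + v * U"])
      (simp_all only: power_Suc UV, simp_all add: algebra_simps power2_eq_square flip: assms)
qed

text \<open>Uses (c + d)^2 - (c - d)^2 = 4 c d with c d = 2 e f. The bound on \<open>m\<close> is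
  linear in e + f, hence the need for factors of nearly equal size.\<close>

lemma diff_squares_eq_8_mult:
  fixes e f :: nat
  assumes "e > 0" "f > 0"
  obtains m m' :: nat where "1 \<le> m'" "m' \<le> m" "m \<le> 2 * (e + f)"
    "(real m)\<^sup>2 - (real m')\<^sup>2 = 8 * real e * real f"
proof -
  note R = that
  have main: thesis if "c \<noteq> d" "c + d \<le> 2 * (e + f)" "c * d = 2 * e * f" for c d :: nat
  proof -
    define m' where "m' = nat \<bar>int c - int d\<bar>"
    have m': "real m' = \<bar>real c - real d\<bar>" unfolding m'_def by simp
    have cd: "real c * real d = 2 * real e * real f"
      using that(3) by (metis of_nat_mult of_nat_numeral)
    show thesis
    proof (rule R[of m' "c + d"])
      show "(real (c + d))\<^sup>2 - (real m')\<^sup>2 = 8 * real e * real f"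
        unfolding m' using cd by (simp add: power2_eq_square algebra_simps)
    qed (use that in \<open>auto simp: m'_def\<close>)
  qed
  \<comment> \<open>The extra factor 2 goes to whichever of \<open>e\<close>, \<open>f\<close> keeps the two factors distinct, so \<open>m' \<noteq> 0\<close>.\<close>
  show thesis
  proof (cases "2 * e = f")
    case True
    then show thesis using main[of e "2 * f"] assms by simp
  next
    case False
    then show thesis using main[of "2 * e" f] by simp
  qed
qed

section \<open>Construction of close pairs of eigenvalues\<close>

text \<open>With X = x^k the eigenvalues are of order at most X^(2 (e + 1)) = X^(L + 1) = z^k, while
  the gap is 8 |Y|^L, roughly X^(-L). As \<open>z\<close> and \<open>C\<close> do not depend on
  \<open>k\<close>, every large N is within a constant factor of such a scale.\<close>

lemma rect_spec_close_pairs: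
  fixes D q :: nat
  assumes q: "q > 0" and \<alpha>: "\<alpha> = sqrt (real D) / real q" "\<alpha> \<notin> \<rat>" and \<epsilon>: "\<epsilon> > 0"
  obtains z C :: real where "z > 1" "C > 0"
    "\<And>k::nat. k \<ge> 1 \<Longrightarrow> \<exists>s\<in>rect_spec \<alpha>. \<exists>t\<in>rect_spec \<alpha>.
       s < t \<and> t \<le> C * z ^ k \<and> t - s \<le> 8 * (z ^ k) powr (-1 + \<epsilon>)"
proof -
  define \<theta> where "\<theta> = sqrt (real D)"
  have \<theta>2: "\<theta>\<^sup>2 = real_of_int (int D)" unfolding \<theta>_def by simp
  have \<theta>\<alpha>: "\<theta> = real q * \<alpha>" using q \<alpha> unfolding \<theta>_def by simp
  have "\<theta> \<notin> \<rat>"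
  proof
    assume "\<theta> \<in> \<rat>"
    then have "\<theta> / real q \<in> \<rat>" by simp
    then show False using \<alpha> unfolding \<theta>_def by simp
  qed
  then have "\<theta> \<noteq> 0" using Rats_0 by metis
  moreover have "\<theta> \<ge> 0" unfolding \<theta>_def by simp
  ultimately have \<theta>0: "\<theta> > 0" by linarith
  have \<alpha>0: "\<alpha> > 0" using \<theta>0 q unfolding \<theta>\<alpha> by (simp add: zero_less_mult_iff)
  obtain u v :: int where x1: "of_int u + of_int v * \<theta> > 1" and y0: "of_int u - of_int v * \<theta> \<noteq> 0"
    and y1: "\<bar>of_int u - of_int v * \<theta>\<bar> \<le> 1"
    and yx: "\<bar>of_int u - of_int v * \<theta>\<bar> \<le> (of_int u + of_int v * \<theta>) powr (\<epsilon> / 2 - 1)"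
    using irrational_sqrt_small_norm[of D "\<epsilon> / 2", folded \<theta>_def, OF \<open>\<theta> \<notin> \<rat>\<close>] \<epsilon> half_gt_zero
    by blast
  define x y where "x = of_int u + of_int v * \<theta>" and "y = of_int u - of_int v * \<theta>"
  note x1 = x1[folded x_def] and y0 = y0[folded y_def] and y1 = y1[folded y_def]
    and yx = yx[folded x_def y_def]
  obtain j where j: "2 / \<epsilon> < 105 ^ j" using real_arch_pow[of 105 "2 / \<epsilon>"] by auto
  obtain e a b where e: "2 * e + 1 = (105::nat) ^ j" and forms: "int_form e a" "int_form e b"
    and fac: "\<And>X Y. X ^ (105 ^ j) - Y ^ (105 ^ j) = (X - Y) * a X Y * b X Y"
    using power_105_power_diff_factor[of j] by blast
  define L :: nat where "L = 105 ^ j"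
  have "odd L" unfolding L_def by simp
  have L0: "L \<ge> 1" unfolding L_def by simp
  have eL: "2 * e + 2 = L + 1" using e unfolding L_def by simp
  have abI: "a X Y \<in> \<int>" "b X Y \<in> \<int>" if "X * Y \<in> \<int>" "X\<^sup>2 + Y\<^sup>2 \<in> \<int>" for X Y
    using forms that unfolding int_form_def by blast+
  obtain A B where A: "A \<ge> 0" "\<And>X Y. \<bar>Y\<bar> \<le> X \<Longrightarrow> \<bar>a X Y\<bar> \<le> A * X ^ e"
    and B: "B \<ge> 0" "\<And>X Y. \<bar>Y\<bar> \<le> X \<Longrightarrow> \<bar>b X Y\<bar> \<le> B * X ^ e"
    using forms unfolding int_form_def by metis
  define z where "z = x ^ (L + 1)"
  have z1: "z > 1" unfolding z_def using x1 L0 by (intro one_less_power) auto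
  \<comment> \<open>Bounds m1 + m2 and n1 + n2 in units of X^(e + 1): q / \<theta> comes from
    \<open>V\<close>, the 1 from \<open>U\<close>.\<close>
  define E where "E = (real q / \<theta> + 1) * A + B"
  have E0: "E \<ge> 0" unfolding E_def using A B \<theta>0 q by simp
  define C where "C = (\<alpha> + 1) * (2 * E)\<^sup>2 + 1"
  have "C > 0" unfolding C_def using \<alpha>0 by (simp add: add_nonneg_pos)
  moreover have "\<exists>s\<in>rect_spec \<alpha>. \<exists>t\<in>rect_spec \<alpha>.
       s < t \<and> t \<le> C * z ^ k \<and> t - s \<le> 8 * (z ^ k) powr (-1 + \<epsilon>)" if k: "k \<ge> 1" for k :: nat
  proof -
    obtain U V :: int where UV: "x ^ k = of_int U + of_int V * \<theta>" "y ^ k = of_int U - of_int V * \<theta>"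
      using quadratic_power_conjugates[OF \<theta>2] unfolding x_def y_def by blast
    define X Y where "X = x ^ k" and "Y = y ^ k"
    have X1: "X > 1" unfolding X_def using x1 k by (intro one_less_power) auto
    have Y1: "\<bar>Y\<bar> \<le> 1" unfolding Y_def using y1 by (simp add: power_abs power_le_one)
    have XY: "\<bar>Y\<bar> \<le> X" "\<bar>- Y\<bar> \<le> X" using X1 Y1 by auto
    have U: "2 * of_int U = X + Y" and V: "2 * of_int V * \<theta> = X - Y"
      using UV unfolding X_def Y_def by auto
    have "X * Y = of_int (U\<^sup>2 - int D * V\<^sup>2)"
      unfolding X_def Y_def UV of_int_diff of_int_mult of_int_power \<theta>2[symmetric] by algebra
    then have XYI: "X * Y \<in> \<int>" by (metis Ints_of_int)
    have "X\<^sup>2 + Y\<^sup>2 = of_int (2 * U\<^sup>2 + 2 * int D * V\<^sup>2)"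
      unfolding X_def Y_def UV of_int_add of_int_mult of_int_power \<theta>2[symmetric] of_int_numeral
      by algebra
    then have X2I: "X\<^sup>2 + Y\<^sup>2 \<in> \<int>" by (metis Ints_of_int)
    have I1: "a X Y \<in> \<int>" "b X Y \<in> \<int>" by (rule abI[OF XYI X2I])+
    have "X * - Y \<in> \<int>" unfolding mult_minus_right by (rule Ints_minus[OF XYI])
    moreover have "X\<^sup>2 + (- Y)\<^sup>2 \<in> \<int>" unfolding power2_minus by (rule X2I)
    ultimately have I2: "a X (- Y) \<in> \<int>" "b X (- Y) \<in> \<int>" by (rule abI)+
    note I = I1 I2
    have nat_abs: "\<exists>n::nat. real n = \<bar>w\<bar>" if w: "w \<in> \<int>" for w :: real
    proof -
      obtain i where "w = of_int i" using w by (rule Ints_cases)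
      then show ?thesis by (intro exI[of _ "nat \<bar>i\<bar>"]) simp
    qed
    \<comment> \<open>The factor \<open>q\<close> turns \<alpha> into \<theta> = q \<alpha>, so that
      \<alpha> m1 m2 = (X^L - Y^L) / 2.\<close>
    obtain m1 where m1: "real m1 = \<bar>real q * of_int V * a X Y\<bar>"
      using nat_abs[of "real q * of_int V * a X Y"] I by (auto intro: Ints_mult)
    obtain m2 where m2: "real m2 = \<bar>b X Y\<bar>" using nat_abs I by blast
    \<comment> \<open>Evaluating at -Y, with L odd, leads to n1 n2 = (X^L + Y^L) / 2.\<close>
    obtain n1 where n1: "real n1 = \<bar>of_int U * a X (-Y)\<bar>"
      using nat_abs[of "of_int U * a X (-Y)"] I by (auto intro: Ints_mult)
    obtain n2 where n2: "real n2 = \<bar>b X (-Y)\<bar>" using nat_abs I by blast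
    have YL: "\<bar>Y ^ L\<bar> \<le> 1" "X ^ L > 1"
      using Y1 X1 L0 by (auto simp: power_abs power_le_one intro: one_less_power)
    have "2 * \<theta> * (of_int V * a X Y * b X Y) = X ^ L - Y ^ L"
      using fac[of X Y] V unfolding L_def by (simp add: mult_ac)
    moreover from this have "of_int V * a X Y * b X Y > 0"
      using YL zero_less_mult_pos[of "2 * \<theta>" "of_int V * a X Y * b X Y"] \<theta>0 by linarith
    moreover have "real m1 * real m2 = real q * \<bar>of_int V * a X Y * b X Y\<bar>"
      unfolding m1 m2 by (simp add: abs_mult)
    ultimately have m: "2 * (\<alpha> * (real m1 * real m2)) = X ^ L - Y ^ L"
      using \<theta>\<alpha> by (simp add: mult_ac)
    have "2 * (of_int U * a X (-Y) * b X (-Y)) = X ^ L + Y ^ L"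
      using fac[of X "-Y"] U \<open>odd L\<close> unfolding L_def by (simp add: mult_ac)
    moreover from this have "of_int U * a X (-Y) * b X (-Y) > 0" using YL by linarith
    ultimately have n: "2 * (real n1 * real n2) = X ^ L + Y ^ L"
      unfolding n1 n2 by (simp add: abs_mult[symmetric] mult_ac abs_of_pos)
    have "2 * (\<alpha> * (real m1 * real m2)) \<noteq> 0" "2 * (real n1 * real n2) \<noteq> 0"
      unfolding m n using YL by linarith+
    then have pos: "m1 > 0" "m2 > 0" "n1 > 0" "n2 > 0" by auto
    obtain c c' where c: "1 \<le> c'" "c' \<le> c" "c \<le> 2 * (m1 + m2)"
      "(real c)\<^sup>2 - (real c')\<^sup>2 = 8 * real m1 * real m2"
      using diff_squares_eq_8_mult[of m1 m2] pos by blast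
    obtain d d' where d: "1 \<le> d'" "d' \<le> d" "d \<le> 2 * (n1 + n2)"
      "(real d)\<^sup>2 - (real d')\<^sup>2 = 8 * real n1 * real n2"
      using diff_squares_eq_8_mult[of n1 n2] pos by blast
    \<comment> \<open>The pairs are crossed so that s - t = \<alpha> (c^2 - c'^2) - (d^2 - d'^2):
      the terms X^L cancel and -8 Y^L remains.\<close>
    define s t where "s = \<alpha> * real c ^ 2 + real d' ^ 2" and "t = \<alpha> * real c' ^ 2 + real d ^ 2"
    have st: "s \<in> rect_spec \<alpha>" "t \<in> rect_spec \<alpha>"
      using c(1,2) d(1,2) le_trans unfolding rect_spec_def s_def t_def by blast+
    have "s - t = \<alpha> * (8 * real m1 * real m2) - 8 * real n1 * real n2"
      unfolding s_def t_def c(4)[symmetric] d(4)[symmetric] by (simp add: algebra_simps)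
    also have "\<dots> = 4 * (2 * (\<alpha> * (real m1 * real m2))) - 4 * (2 * (real n1 * real n2))"
      by simp
    also have "\<dots> = - 8 * Y ^ L" unfolding m n by simp
    finally have diff: "s - t = - 8 * Y ^ L" .
    have "s \<noteq> t" using diff y0 unfolding Y_def by auto
    have "\<bar>Y ^ L\<bar> = \<bar>y\<bar> ^ (k * L)" unfolding Y_def by (simp add: power_abs flip: power_mult)
    also have "\<dots> \<le> (x powr (\<epsilon> / 2 - 1)) ^ (k * L)" using yx by (intro power_mono) auto
    also have "\<dots> = x powr ((\<epsilon> / 2 - 1) * (real k * real L))"
      using x1 by (simp add: powr_powr flip: powr_realpow)
    also have "\<dots> \<le> x powr ((real k * (real L + 1)) * (-1 + \<epsilon>))"
    proof (rule powr_mono)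
      \<comment> \<open>Half of \<epsilon> went into the norm bound; the other half pays for L + 1.
        Expanded, the claim is 1 \<le> \<epsilon> + \<epsilon> L / 2.\<close>
      have "1 \<le> \<epsilon> / 2 * real L" using j \<epsilon> unfolding L_def by (simp add: field_simps)
      then have "(\<epsilon> / 2 - 1) * real L \<le> (real L + 1) * (-1 + \<epsilon>)"
        using \<epsilon> by (simp add: algebra_simps)
      from mult_left_mono[OF this, of "real k"]
      show "(\<epsilon> / 2 - 1) * (real k * real L) \<le> (real k * (real L + 1)) * (-1 + \<epsilon>)"
        by (simp add: mult_ac)
    qed (use x1 in auto)
    also have "\<dots> = (z ^ k) powr (-1 + \<epsilon>)"
    proof -
      have "z ^ k = x powr (real k * (real L + 1))"
        using x1 unfolding z_def power_mult[symmetric]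
        by (simp add: powr_realpow[symmetric] algebra_simps)
      then show ?thesis by (simp add: powr_powr)
    qed
    finally have gap: "\<bar>s - t\<bar> \<le> 8 * (z ^ k) powr (-1 + \<epsilon>)" unfolding diff by (simp add: abs_mult)
    have X_le: "X ^ e \<le> X ^ (e + 1)" using X1 by (intro power_increasing) auto
    have Vb: "real q * \<bar>of_int V\<bar> \<le> real q / \<theta> * X"
    proof -
      have "\<bar>2 * of_int V * \<theta>\<bar> \<le> 2 * X" unfolding V using XY by linarith
      then have "\<bar>of_int V\<bar> * \<theta> \<le> X" using \<theta>0 by (simp add: abs_mult)
      then have "\<bar>of_int V\<bar> \<le> X / \<theta>" using \<theta>0 by (simp add: field_simps)
      from mult_left_mono[OF this, of "real q"] show ?thesis by simp
    qed
    have Ub: "\<bar>of_int U\<bar> \<le> X" using U XY by linarith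
    have bnd: "real m1 + real m2 \<le> E * X ^ (e + 1)" "real n1 + real n2 \<le> E * X ^ (e + 1)"
    proof -
      have "real m1 \<le> (real q / \<theta> * X) * (A * X ^ e)"
        unfolding m1 abs_mult abs_of_nat using X1 \<theta>0
        by (intro mult_mono[OF Vb A(2)[OF XY(1)]]) auto
      moreover have "real m2 \<le> B * X ^ (e + 1)"
        unfolding m2 using B(2)[OF XY(1)] X_le B(1) by (meson mult_left_mono order_trans)
      moreover have "0 \<le> A * X ^ (e + 1)" using A X1 by simp
      ultimately show "real m1 + real m2 \<le> E * X ^ (e + 1)"
        unfolding E_def by (simp add: algebra_simps)
      have "real n1 \<le> X * (A * X ^ e)"
        unfolding n1 abs_mult using X1
        by (intro mult_mono[OF Ub A(2)[OF XY(2)]]) auto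
      moreover have "real n2 \<le> B * X ^ (e + 1)"
        unfolding n2 using B(2)[OF XY(2)] X_le B(1) by (meson mult_left_mono order_trans)
      moreover have "0 \<le> real q / \<theta> * (A * X ^ (e + 1))" using A X1 \<theta>0 by simp
      ultimately show "real n1 + real n2 \<le> E * X ^ (e + 1)"
        unfolding E_def by (simp add: algebra_simps)
    qed
    define R where "R = 2 * E * X ^ (e + 1)"
    have R2: "R\<^sup>2 = (2 * E)\<^sup>2 * z ^ k"
    proof -
      have "(X ^ (e + 1))\<^sup>2 = x ^ (k * (2 * e + 2))"
        unfolding X_def by (simp add: algebra_simps power_add flip: power_mult)
      also have "\<dots> = z ^ k" unfolding z_def eL by (simp only: mult.commute[of k] power_mult)
      finally show ?thesis unfolding R_def power_mult_distrib[of "2 * E"] by simp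
    qed
    have mR: "2 * (real m1 + real m2) \<le> R" and nR: "2 * (real n1 + real n2) \<le> R"
      using bnd unfolding R_def mult.assoc by simp_all
    have "real c \<le> 2 * (real m1 + real m2)" "real d \<le> 2 * (real n1 + real n2)"
      "real c' \<le> real c" "real d' \<le> real d"
      using c(2,3) d(2,3) by simp_all
    then have "real c \<le> R" "real c' \<le> R" "real d \<le> R" "real d' \<le> R"
      using mR nR by simp_all
    then have sq: "real c ^ 2 \<le> R\<^sup>2" "real c' ^ 2 \<le> R\<^sup>2" "real d ^ 2 \<le> R\<^sup>2" "real d' ^ 2 \<le> R\<^sup>2"
      by (auto intro: power_mono)
    have "w \<le> C * z ^ k" if "w = \<alpha> * f + g" "f \<le> R\<^sup>2" "g \<le> R\<^sup>2" for w f g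
    proof -
      have "w \<le> \<alpha> * R\<^sup>2 + R\<^sup>2"
        unfolding that(1) using \<alpha>0 by (intro add_mono mult_left_mono that) auto
      also have "\<dots> \<le> C * z ^ k" unfolding R2 C_def using z1 by (simp add: algebra_simps)
      finally show ?thesis .
    qed
    from this[OF s_def sq(1,4)] this[OF t_def sq(2,3)]
    have "s \<le> C * z ^ k" "t \<le> C * z ^ k" .
    \<comment> \<open>The sign of Y^L is unknown, so \<open>s\<close> and \<open>t\<close> may have
      to swap roles.\<close>
    moreover have "s < t \<and> t - s \<le> 8 * (z ^ k) powr (-1 + \<epsilon>) \<or>
        t < s \<and> s - t \<le> 8 * (z ^ k) powr (-1 + \<epsilon>)"
      using gap \<open>s \<noteq> t\<close> by linarith
    ultimately show ?thesis using st by blast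
  qed
  ultimately show thesis using that z1 by blast
qed

section \<open>Passage from the scales z^k to all N\<close>

theorem theorem1p1:
  fixes r :: rat and \<alpha> :: real
  assumes "r > 0"
    and "\<alpha> = sqrt (of_rat r)"
    and "\<alpha> \<notin> \<rat>"
  shows "\<forall>\<epsilon>>0. \<exists>C>0. \<forall>N::nat. N \<ge> 2 \<longrightarrow>
           delta_min \<alpha> N \<le> C * real N powr (-1 + \<epsilon>)"
proof (intro allI impI)
  fix \<epsilon> :: real assume "\<epsilon> > 0"
  \<comment> \<open>Capping at 1 keeps -1 + \<delta> nonpositive, as needed when z^k is replaced by
    its lower bound N / N0.\<close>
  define \<delta> where "\<delta> = min \<epsilon> 1"
  have \<delta>: "\<delta> > 0" "\<delta> \<le> 1" "\<delta> \<le> \<epsilon>" using \<open>\<epsilon> > 0\<close> unfolding \<delta>_def by auto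
  obtain p q :: nat where pq: "p > 0" "q > 0" "of_rat r = real p / real q"
  proof -
    obtain a b where ab: "r = Fract a b" "b > 0" using Rat_cases by metis
    then have "a > 0" using \<open>r > 0\<close> by (simp add: zero_less_Fract_iff)
    then show thesis using that[of "nat a" "nat b"] ab by (simp add: of_rat_rat)
  qed
  have \<alpha>0: "\<alpha> > 0" using assms(1,2) by simp
  \<comment> \<open>Clearing the denominator under the root supplies D = p q.\<close>
  have "sqrt (real p / real q) = sqrt (real (p * q)) / real q"
    using pq by (simp add: real_sqrt_divide real_sqrt_mult field_simps)
  then have "\<alpha> = sqrt (real (p * q)) / real q" using assms(2) pq by simp
  then obtain z C where z: "z > 1" and C: "C > 0" and close: "\<And>k::nat. k \<ge> 1 \<Longrightarrow>
      \<exists>s\<in>rect_spec \<alpha>. \<exists>t\<in>rect_spec \<alpha>. s < t \<and> t \<le> C * z ^ k \<and> t - s \<le> 8 * (z ^ k) powr (-1 + \<delta>)"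
    using rect_spec_close_pairs[OF pq(2) _ assms(3) \<delta>(1)] by blast
  define c where "c = C / sqrt \<alpha>"
  have c: "c > 0" unfolding c_def using C \<alpha>0 by simp
  define N0 where "N0 = c * z"
  have N0: "N0 > 0" unfolding N0_def using c z by simp
  define g where "g = \<bar>rect_eig \<alpha> 2 - rect_eig \<alpha> 1\<bar>"
  \<comment> \<open>The first entry serves N \<ge> \<open>N0\<close>, the second the finitely many
    smaller N.\<close>
  define K where "K = max (8 * N0 powr (1 - \<delta>)) (g * N0)"
  have K0: "K > 0" unfolding K_def using N0 by (simp add: less_max_iff_disj)
  have "delta_min \<alpha> N \<le> K * real N powr (-1 + \<epsilon>)" if N: "N \<ge> 2" for N :: nat
  proof -
    have "delta_min \<alpha> N \<le> K * real N powr (-1 + \<delta>)"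
    proof (cases "real N < N0")
      case True
      \<comment> \<open>The first gap always enters the minimum, and here N0 / N > 1.\<close>
      have "delta_min \<alpha> N \<le> g"
        using delta_min_le_rect_eig_diff[of 1 N \<alpha>] N unfolding g_def by (simp add: numeral_2_eq_2)
      also have "\<dots> \<le> g * (N0 / real N)"
        using True N mult_left_mono[of 1 "N0 / real N" g] unfolding g_def by simp
      also have "\<dots> = (g * N0) * real N powr (-1)" using N by (simp add: powr_minus_divide)
      also have "\<dots> \<le> K * real N powr (-1 + \<delta>)"
        using N \<delta> K0 by (intro mult_mono powr_mono) (auto simp: K_def)
      finally show ?thesis .
    next
      case False
      \<comment> \<open>The largest k with c z^k \<le> N: at most N eigenvalues lie below C z^k, and
        z^k is at least N / N0.\<close>
      define k where "k = nat \<lfloor>log z (real N / c)\<rfloor>"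
      have Nc: "real N / c > 0" using N c by simp
      have "z \<le> real N / c" using False c unfolding N0_def by (simp add: field_simps)
      then have "log z (real N / c) \<ge> 1" using z Nc by (simp add: le_log_iff)
      then have k: "k \<ge> 1" "real k \<le> log z (real N / c)" "log z (real N / c) < real (Suc k)"
        unfolding k_def by linarith+
      have zk: "z ^ k \<le> real N / c" 
        using k(2) z Nc by (simp add: le_log_iff powr_realpow)
      have "real N / c < z ^ Suc k"
        using k(3) z Nc by (simp only: log_less_iff powr_realpow)
      then have zk': "real N / N0 \<le> z ^ k"
        using c z unfolding N0_def by (simp add: field_simps)
      obtain s t where st: "s \<in> rect_spec \<alpha>" "t \<in> rect_spec \<alpha>" "s < t" "t \<le> C * z ^ k"
        "t - s \<le> 8 * (z ^ k) powr (-1 + \<delta>)"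
        using close[OF k(1)] by blast
      have "t \<ge> 0" using st(2) \<alpha>0 unfolding rect_spec_def by auto
      then have "real (card {y \<in> rect_spec \<alpha>. y \<le> t}) \<le> t / sqrt \<alpha>"
        using card_rect_spec_atMost[OF \<alpha>0] by simp
      also have "\<dots> \<le> C * z ^ k / sqrt \<alpha>" using st(4) \<alpha>0 by (intro divide_right_mono) auto
      also have "\<dots> = c * z ^ k" unfolding c_def by simp
      also have "\<dots> \<le> real N" using zk c by (simp add: field_simps)
      finally have "card {y \<in> rect_spec \<alpha>. y \<le> t} \<le> N" by simp
      then have "delta_min \<alpha> N \<le> t - s" using delta_min_le_diff[OF \<alpha>0 st(1-3)] by simp
      also have "\<dots> \<le> 8 * (z ^ k) powr (-1 + \<delta>)" by (rule st)
      also have "\<dots> \<le> 8 * (real N / N0) powr (-1 + \<delta>)"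
        using zk' N N0 \<delta> by (intro mult_left_mono powr_mono2') auto
      also have "\<dots> = (8 * N0 powr (1 - \<delta>)) * real N powr (-1 + \<delta>)"
        using N N0 powr_minus_divide[of N0 "1 - \<delta>"] by (simp add: powr_divide)
      also have "\<dots> \<le> K * real N powr (-1 + \<delta>)" unfolding K_def by (intro mult_right_mono) auto
      finally show ?thesis .
    qed
    also have "\<dots> \<le> K * real N powr (-1 + \<epsilon>)"
      using K0 N \<delta> by (intro mult_left_mono powr_mono) auto
    finally show ?thesis .
  qed
  then show "\<exists>C>0. \<forall>N::nat. N \<ge> 2 \<longrightarrow> delta_min \<alpha> N \<le> C * real N powr (-1 + \<epsilon>)"
    using K0 by blast
qed

end
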